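(* Let $\mathcal{V}=\{1,\dots,n\}$, $n\ge 2$, be a set of $n$ points (nodes) in the Euclidean plane with distinct inter-point distances, and let $\mathcal{E}$ be the edge set of its (undirected) nearest-neighbor graph. Let $\sigma_0,\sigma_1>0$. Consider the hypotheses on the observation vector $\mathbf{Y}_n=(Y_1,\dots,Y_n)^T$ $$\mathcal{H}_0:\ \mathbf{Y}_n\sim\mathcal{N}(\mathbf{0},\sigma_0^2\mathbf{I})\qquad\text{vs.}\qquad \mathcal{H}_1:\ \mathbf{Y}_n\sim\mathcal{N}(\mathbf{0},\mathbf{\Sigma}_{1,\mathcal{V}}),$$ where under $\mathcal{H}_1$ the vector $\mathbf{Y}_n$ is a Gauss-Markov random field whose dependency graph is the nearest-neighbor graph of $\mathcal{V}$, $\mathbf{\Sigma}_{1,\mathcal{V}}$ is positive definite, $\Sigma_{1,\mathcal{V}}(i,i)=\sigma_1^2$ for all $i$, and $\Sigma_{1,\mathcal{V}}(i,j)=\sigma_1^2\, g(R_{ij})$ for all $(i,j)\in\mathcal{E}$, where $R_{ij}$ is the Euclidean length of the edge $(i,j)$ and $g$ is a real function with $g(R_{ij})<1$. Then the log-likelihood ratio $\mathrm{LLR}(\mathbf{Y}_n,\mathcal{V}):=\log\frac{p[\mathbf{Y}_n;\mathcal{H}_0]}{p[\mathbf{Y}_n|\mathcal{V};\mathcal{H}_1]}$ equals $$\mathrm{LLR}(\mathbf{Y}_n,\mathcal{V})=n\log\frac{\sigma_1}{\sigma_0}+\frac12\Biggl[\sum_{i\in\mathcal{V}}\Bigl(\frac1{\sigma_1^2}-\frac1{\sigma_0^2}\Bigr)Y_i^2+\sum_{\substack{(i,j)\in\mathcal{E}\\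 i<j}}\Bigl\{\log[1-g^2(R_{ij})]+\frac{g^2(R_{ij})}{1-g^2(R_{ij})}\frac{Y_i^2+Y_j^2}{\sigma_1^2}-\frac{2g(R_{ij})}{1-g^2(R_{ij})}\frac{Y_iY_j}{\sigma_1^2}\Bigr\}\Biggr].$$
   Context: For a node $i\in\mathcal{V}$, its nearest neighbor is $\mathrm{nn}(i):=\arg\min_{j\in\mathcal{V},j\ne i}\mathrm{dist}(i,j)$ (Euclidean distance). The (undirected) nearest-neighbor graph on $\mathcal{V}$ has edge set $\mathcal{E}$ given by: $(i,j)\in\mathcal{E}$ iff $i=\mathrm{nn}(j)$ or $j=\mathrm{nn}(i)$. $\mathbf{Y}$ is a Gauss-Markov random field with dependency graph $(\mathcal{V},\mathcal{E})$ if it is Gaussian and, for all $i\neq j$, $Y_i$ and $Y_j$ are conditionally independent given all the other observations $(Y_k:k\neq i,j)$ if and only if $(i,j)\notin\mathcal{E}$. $p[\mathbf{Y}_n;\mathcal{H}_0]$ and $p[\mathbf{Y}_n|\mathcal{V};\mathcal{H}_1]$ are the probability density functions of $\mathbf{Y}_n$ under the two hypotheses (given the point set $\mathcal{V}$). *)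

theory Defs
  imports "HOL-Probability.Probability"
begin

text \<open>Nodes are the elements of a finite index type; node \<open>i\<close> has position \<open>x i\<close>.\<close>

definition distinct_distances :: "('n \<Rightarrow> 'a::metric_space) \<Rightarrow> bool" where
  "distinct_distances x \<longleftrightarrow>
     (\<forall>i j k l. i \<noteq> j \<longrightarrow> k \<noteq> l \<longrightarrow> {i, j} \<noteq> {k, l} \<longrightarrow> dist (x i) (x j) \<noteq> dist (x k) (x l))"

text \<open>The minimiser exists and is unique when there are at least two nodes and all
  inter-point distances are distinct.\<close>

definition nn :: "('n::finite \<Rightarrow> 'a::metric_space) \<Rightarrow> 'n \<Rightarrow> 'n" where
  "nn x i = arg_min_on (\<lambda>j. dist (x i) (x j)) (UNIV - {i})"

text \<open>An undirected edge is represented by both of its ordered pairs.\<close>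

definition nng_edges :: "('n::finite \<Rightarrow> 'a::metric_space) \<Rightarrow> ('n \<times> 'n) set" where
  "nng_edges x = {(i, j). i = nn x j \<or> j = nn x i}"

definition pos_def :: "real^'n^'n \<Rightarrow> bool" where
  "pos_def A \<longleftrightarrow> transpose A = A \<and> (\<forall>v. v \<noteq> 0 \<longrightarrow> v \<bullet> (A *v v) > 0)"

definition mvn_density :: "real^'n \<Rightarrow> real^'n^'n \<Rightarrow> real^'n \<Rightarrow> real" where
  "mvn_density \<mu> \<Sigma> y =
     exp (- ((y - \<mu>) \<bullet> (matrix_inv \<Sigma> *v (y - \<mu>))) / 2) / sqrt ((2 * pi) ^ CARD('n) * det \<Sigma>)"

text \<open>Nondegenerate normal vector with mean \<open>\<mu>\<close> and covariance matrix \<open>\<Sigma>\<close>.\<close>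

definition gaussian_vector ::
  "'w measure \<Rightarrow> ('w \<Rightarrow> real^'n) \<Rightarrow> real^'n \<Rightarrow> real^'n^'n \<Rightarrow> bool" where
  "gaussian_vector M Y \<mu> \<Sigma> \<longleftrightarrow>
     prob_space M \<and> pos_def \<Sigma> \<and> distributed M lborel Y (mvn_density \<mu> \<Sigma>)"

text \<open>Conditional independence of two real random variables given a sub-sigma-algebra \<open>F\<close>:
  almost surely, $P(X \in A, Z \in B \mid F) = P(X \in A \mid F)\, P(Z \in B \mid F)$.\<close>

definition cond_indep_var ::
  "'w measure \<Rightarrow> 'w measure \<Rightarrow> ('w \<Rightarrow> real) \<Rightarrow> ('w \<Rightarrow> real) \<Rightarrow> bool" where
  "cond_indep_var M F X Z \<longleftrightarrow>
     (\<forall>A\<in>sets borel. \<forall>B\<in>sets borel. AE \<omega> in M.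
        real_cond_exp M F (\<lambda>\<omega>. indicator A (X \<omega>) * indicator B (Z \<omega>)) \<omega> =
        real_cond_exp M F (\<lambda>\<omega>. indicator A (X \<omega>)) \<omega> *
        real_cond_exp M F (\<lambda>\<omega>. indicator B (Z \<omega>)) \<omega>)"

text \<open>The sigma-algebra generated by the subvector \<open>(Y\<^sub>k)\<close>, \<open>k \<in> K\<close>; it is the trivial one
  for \<open>K = {}\<close>.\<close>

definition coord_algebra :: "'w measure \<Rightarrow> ('w \<Rightarrow> real^'n) \<Rightarrow> 'n set \<Rightarrow> 'w measure" where
  "coord_algebra M Y K =
     vimage_algebra (space M) (\<lambda>\<omega>. \<lambda>k\<in>K. Y \<omega> $ k) (\<Pi>\<^sub>M k\<in>K. borel)"

definition gauss_markov_field ::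
  "'w measure \<Rightarrow> ('w \<Rightarrow> real^'n) \<Rightarrow> real^'n \<Rightarrow> real^'n^'n \<Rightarrow> ('n \<times> 'n) set \<Rightarrow> bool" where
  "gauss_markov_field M Y \<mu> \<Sigma> E \<longleftrightarrow>
     gaussian_vector M Y \<mu> \<Sigma> \<and>
     (\<forall>i j. i \<noteq> j \<longrightarrow>
        (cond_indep_var M (coord_algebra M Y (- {i, j})) (\<lambda>\<omega>. Y \<omega> $ i) (\<lambda>\<omega>. Y \<omega> $ j)
         \<longleftrightarrow> (i, j) \<notin> E))"

end

theory Submission
  imports Defs
begin

text \<open>Nearest-neighbour distances do not increase along nearest-neighbour pointers, so the node of
  any set \<open>W\<close> with the largest one is a leaf of the graph induced on \<open>W\<close>: the graph is a forest.
  By the Markov property the precision matrix vanishes off its edges. Eliminating a leaf \<open>i\<close> with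
  neighbour \<open>p\<close> and correlation \<open>\<rho>\<close> splits the quadratic form into
  \<open>(y\<^sub>i - \<rho> y\<^sub>p)\<^sup>2 / (\<sigma>\<^sup>2 (1 - \<rho>\<^sup>2))\<close> and that of the remaining nodes, and the determinant of the
  covariance into \<open>\<sigma>\<^sup>2 (1 - \<rho>\<^sup>2)\<close> and the remaining minor; induction gives one term per edge.\<close>

subsection \<open>Leaf elimination in forest-structured covariance matrices\<close>

text \<open>The condition \<open>i < j\<close> picks one representative of each undirected edge, so
  sums and products count it once. \<open>V\<close> will be the set of nodes not yet
  eliminated.\<close>

definition edges_on :: "('n::linorder \<times> 'n) set \<Rightarrow> 'n set \<Rightarrow> ('n \<times> 'n) set" where
  "edges_on E V = {(i, j). (i, j) \<in> E \<and> i \<in> V \<and> j \<in> V \<and> i < j}"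

text \<open>The elimination order is unrelated to the order on nodes, so the leaf may be either end
  of the stored pair; hence \<open>min\<close> and \<open>max\<close>. With the second claim, one
  term splits off each sum or product over edges.\<close>

lemma edges_on_remove_leaf:
  fixes E :: "('n::linorder \<times> 'n) set"
  assumes symE: "sym E" and irr: "irrefl E" and "i \<in> V" "p \<in> V" and ip: "(i, p) \<in> E"
    and leaf: "\<And>j. j \<in> V \<Longrightarrow> (i, j) \<in> E \<Longrightarrow> j = p"
  shows "edges_on E V = insert (min i p, max i p) (edges_on E (V - {i}))"
    and "(min i p, max i p) \<notin> edges_on E (V - {i})"
proof -
  have "i \<noteq> p" using irr ip by (auto simp: irrefl_def)
  have leaf': "j = p" if "j \<in> V" "(j, i) \<in> E" for j
    using leaf that symE by (auto dest: symD)
  have pi: "(p, i) \<in> E" using ip symE by (auto dest: symD)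
  show "edges_on E V = insert (min i p, max i p) (edges_on E (V - {i}))"
    using \<open>i \<noteq> p\<close> assms(3,4) ip pi
    by (auto simp: edges_on_def min_def max_def dest: leaf leaf')
  show "(min i p, max i p) \<notin> edges_on E (V - {i})"
    using \<open>i \<noteq> p\<close> by (auto simp: edges_on_def min_def max_def)
qed

lemma quadratic_form_sum:
  fixes y :: "real^'n"
  shows "y \<bullet> (A *v y) = (\<Sum>k\<in>UNIV. \<Sum>l\<in>UNIV. y $ k * A $ k $ l * y $ l)"
  by (simp add: inner_vec_def matrix_vector_mult_def sum_distrib_left mult.assoc)

text \<open>In the leaf elimination \<open>c\<close> is the conditional precision of the leaf,
  \<open>w\<close> extracts its residual \<open>y $ i - \<rho> * y $ p\<close>, and \<open>d\<close>
  is the marginal precision that the decoupled leaf has in \<open>J'\<close>.\<close>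

lemma quadratic_form_rank_one_update:
  fixes y w :: "real^'n"
  assumes "\<And>k l. J $ k $ l = J' $ k $ l + c * (w $ k * w $ l) - d * (axis i 1 $ k * axis i 1 $ l)"
  shows "y \<bullet> (J *v y) = y \<bullet> (J' *v y) + c * (y \<bullet> w)\<^sup>2 - d * (y $ i)\<^sup>2"
proof -
  have *: "(\<Sum>k\<in>UNIV. \<Sum>l\<in>UNIV. e * (y $ k * u $ k * (u $ l * y $ l))) = e * (y \<bullet> u)\<^sup>2" for e and u :: "real^'n"
    by (simp add: inner_vec_def power2_eq_square sum_product sum_distrib_left mult_ac)
  have "y \<bullet> (J *v y) = (\<Sum>k\<in>UNIV. \<Sum>l\<in>UNIV. y $ k * J' $ k $ l * y $ l
      + c * (y $ k * w $ k * (w $ l * y $ l))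
      - d * (y $ k * axis i 1 $ k * (axis i 1 $ l * y $ l)))"
    unfolding quadratic_form_sum assms by (intro sum.cong refl) (simp add: algebra_simps)
  also have "\<dots> = y \<bullet> (J' *v y) + c * (y \<bullet> w)\<^sup>2 - d * (y \<bullet> axis i 1)\<^sup>2"
    by (simp only: sum.distrib sum_subtractf * quadratic_form_sum)
  finally show ?thesis by (simp add: inner_axis)
qed

text \<open>Subtracting \<open>r\<close> times row \<open>p\<close> from row \<open>i\<close>, and
  then the same with columns, clears row and column \<open>i\<close> except for the diagonal entry
  \<open>s * (1 - r\<^sup>2)\<close>.\<close>

lemma det_eliminate_row_column:
  fixes S :: "real^'n^'n"
  assumes "i \<noteq> p" and symS: "\<And>k l. S $ k $ l = S $ l $ k"
    and row: "\<And>k. k \<noteq> i \<Longrightarrow> S $ i $ k = r * S $ p $ k"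
    and Sii: "S $ i $ i = s"
    and T: "\<And>k l. T $ k $ l = (if k = i \<or> l = i then if k = l then s else 0 else S $ k $ l)"
    and Spi: "S $ p $ i = s * r"
  shows "det S = (1 - r\<^sup>2) * det T"
proof -
  define A where "A = (\<chi> k. if k = i then row i S + (-r) *s row p S else row k S)"
  \<comment> \<open>A column operation, carried out as a row operation on the transpose. The result
    needs no transposing back because \<open>S\<close> is symmetric.\<close>
  define B where "B = (\<chi> k. if k = i then row i (transpose A) + (-r) *s row p (transpose A)
    else row k (transpose A))"
  have "det S = det A"
    unfolding A_def by (rule det_row_operation[OF \<open>i \<noteq> p\<close>, symmetric])
  also have "\<dots> = det B"
    unfolding B_def by (subst det_row_operation[OF \<open>i \<noteq> p\<close>]) (simp add: det_transpose)
  also have "B = (\<chi> k. if k = i then (1 - r\<^sup>2) *s row i T else row k T)"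
  proof -
    have col: "S $ k $ i = r * S $ k $ p" if "k \<noteq> i" for k
      using row[OF that] symS[of k i] symS[of k p] by simp
    have "S $ i $ p = s * r" using Spi symS[of i p] by simp
    then have "B $ k $ l = (\<chi> k. if k = i then (1 - r\<^sup>2) *s row i T else row k T) $ k $ l" for k l
      using \<open>i \<noteq> p\<close> Sii Spi row[of k] row[of p] row[of l] col[of l] symS[of k l]
      by (auto simp add: B_def A_def row_def transpose_def T power2_eq_square algebra_simps)
    then show ?thesis by (simp add: vec_eq_iff)
  qed
  also have "det \<dots> = (1 - r\<^sup>2) * det (\<chi> k. if k = i then row i T else row k T)"
    by (rule det_row_mul)
  also have "(\<chi> k. if k = i then row i T else row k T) = T"
    by (auto simp: vec_eq_iff row_def)
  finally show ?thesis .
qed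

text \<open>The matrices keep their full size during the induction on \<open>card V\<close>. An
  eliminated node becomes uncorrelated with all others but keeps variance \<open>s\<close>, so the
  sum over all nodes and the factor \<open>s ^ CARD('n)\<close> are the same at every stage and only
  edge terms change. The last assumption confines the off-diagonal support of \<open>J\<close> to
  edges inside \<open>V\<close>, so \<open>J\<close> is diagonal once \<open>V\<close> is
  empty.\<close>

lemma forest_precision:
  fixes S J :: "real^('n::{finite,linorder})^('n::{finite,linorder})" and y :: "real^('n::{finite,linorder})"
    and E :: "('n \<times> 'n) set"
  assumes leaf: "\<And>W. W \<noteq> {} \<Longrightarrow> \<exists>i\<in>W. \<exists>p. \<forall>j\<in>W. (i, j) \<in> E \<longrightarrow> j = p"
    and symE: "sym E" and irr: "irrefl E"
    and symr: "\<And>k l. r k l = r l k" and s: "s \<noteq> 0"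
    and "\<And>k l. S $ k $ l = S $ l $ k" and "\<And>k l. J $ k $ l = J $ l $ k"
    and "S ** J = mat 1"
    and "\<And>k. S $ k $ k = s"
    and "\<And>k l. (k, l) \<in> E \<Longrightarrow> k \<in> V \<Longrightarrow> l \<in> V \<Longrightarrow> S $ k $ l = s * r k l"
    and "\<And>k l. k \<noteq> l \<Longrightarrow> J $ k $ l \<noteq> 0 \<Longrightarrow> (k, l) \<in> E \<and> k \<in> V \<and> l \<in> V"
  shows "y \<bullet> (J *v y) = (\<Sum>k\<in>UNIV. (y $ k)\<^sup>2 / s) + (\<Sum>(k, l)\<in>edges_on E V.
      (r k l)\<^sup>2 / (1 - (r k l)\<^sup>2) * (((y $ k)\<^sup>2 + (y $ l)\<^sup>2) / s) -
      2 * r k l / (1 - (r k l)\<^sup>2) * (y $ k * y $ l / s))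
    \<and> det S = s ^ CARD('n) * (\<Prod>(k, l)\<in>edges_on E V. 1 - (r k l)\<^sup>2)"
  using assms(6-11)
proof (induction "card V" arbitrary: V S J rule: less_induct)
  case less
  note symS = less.prems(1) and symJ = less.prems(2) and inv = less.prems(3) and diag = less.prems(4)
    and edge = less.prems(5) and sparse = less.prems(6)
  have inv_nth: "(\<Sum>m\<in>UNIV. S $ k $ m * J $ m $ l) = (if k = l then 1 else 0)" for k l
    using inv by (simp add: vec_eq_iff matrix_matrix_mult_def mat_def)
  show ?case
  proof (cases "V = {}")
    case True
    have J0: "J $ k $ l = 0" if "k \<noteq> l" for k l using sparse that True by auto
    have sJ: "S $ k $ l * J $ l $ l = (if k = l then 1 else 0)" for k l
    proof -
      have "(\<Sum>m\<in>UNIV. S $ k $ m * J $ m $ l) = (\<Sum>m\<in>UNIV. if m = l then S $ k $ l * J $ l $ l else 0)"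
        using J0 by (intro sum.cong) auto
      then show ?thesis using inv_nth[of k l] by simp
    qed
    have Jd: "J $ k $ k = 1 / s" for k using sJ[of k k] diag[of k] s by (simp add: field_simps)
    have "S $ k $ l = 0" if "k \<noteq> l" for k l using sJ[of k l] that Jd s by simp
    then have "det S = s ^ CARD('n)" by (subst det_diagonal) (auto simp: diag)
    moreover have "y \<bullet> (J *v y) = (\<Sum>k\<in>UNIV. \<Sum>l\<in>UNIV. if l = k then (y $ k)\<^sup>2 / s else 0)"
      unfolding quadratic_form_sum using J0 Jd by (intro sum.cong) (auto simp: power2_eq_square)
    ultimately show ?thesis using True by (simp add: edges_on_def)
  next
    case False
    obtain i p where iV: "i \<in> V" and ip: "\<And>j. j \<in> V \<Longrightarrow> (i, j) \<in> E \<Longrightarrow> j = p"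
      using leaf[OF False] by blast
    have card: "card (V - {i}) < card V" using iV by (intro psubset_card_mono) auto
    show ?thesis
    proof (cases "p \<in> V \<and> (i, p) \<in> E")
      \<comment> \<open>Here \<open>i\<close> has no neighbour in \<open>V\<close>. It is already
        decoupled, so \<open>V\<close> shrinks while \<open>S\<close> and \<open>J\<close>
        stay.\<close>
      case False
      then have iso: "(i, j) \<notin> E \<and> (j, i) \<notin> E" if "j \<in> V" for j
        using ip that symE by (auto dest: symD)
      have "edges_on E (V - {i}) = edges_on E V" using iso by (auto simp: edges_on_def)
      moreover have sparse': "(k, l) \<in> E \<and> k \<in> V - {i} \<and> l \<in> V - {i}"
        if "k \<noteq> l" "J $ k $ l \<noteq> 0" for k l
        using sparse[OF that] iso by auto
      moreover have edge': "S $ k $ l = s * r k l" if "(k, l) \<in> E" "k \<in> V - {i}" "l \<in> V - {i}" for k l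
        using edge that by auto
      ultimately show ?thesis
        using less.hyps[OF card symS symJ inv diag edge' sparse'] by simp
    next
      case True
      then have pV: "p \<in> V" and ipE: "(i, p) \<in> E" and pne: "i \<noteq> p" using irr by (auto simp: irrefl_def)
      define \<rho> where "\<rho> = r i p"
      \<comment> \<open>\<open>y \<bullet> w\<close> is the residual of the leaf given its
        neighbour. \<open>T\<close> decouples \<open>i\<close> in the covariance, and
        \<open>K\<close> is the matching precision: it drops the residual term
        \<open>a * (y \<bullet> w)\<^sup>2\<close> and gives \<open>i\<close> the marginal precision
        \<open>1 / s\<close>.\<close>
      define w :: "real^('n::{finite,linorder})" where "w = axis i 1 - \<rho> *\<^sub>R axis p 1"
      define a where "a = J $ i $ i"
      define T :: "real^('n::{finite,linorder})^('n::{finite,linorder})" where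
        "T = (\<chi> k l. if k = i \<or> l = i then if k = l then s else 0 else S $ k $ l)"
      define K :: "real^('n::{finite,linorder})^('n::{finite,linorder})" where
        "K = (\<chi> k l. J $ k $ l - a * (w $ k * w $ l) + 1 / s * (axis i 1 $ k * axis i 1 $ l))"
      have w_nth: "w $ k = (if k = i then 1 else if k = p then - \<rho> else 0)" for k
        using pne by (auto simp: w_def axis_def)
      have Sip: "S $ i $ p = s * \<rho>" using edge[OF ipE iV pV] by (simp add: \<rho>_def)
      have Ji0: "J $ m $ i = 0" if "m \<noteq> i" "m \<noteq> p" for m
        using sparse[of i m] that ip symJ[of i m] by auto
      \<comment> \<open>Column \<open>i\<close> of \<open>S ** J = mat 1\<close>. Column
        \<open>i\<close> of \<open>J\<close> vanishes off \<open>i\<close> and \<open>p\<close>,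
        which leaves two terms; this small system determines \<open>J $ p $ i\<close> and
        \<open>a\<close>, and yields \<open>row\<close>.\<close>
      have two: "S $ k $ i * a + S $ k $ p * J $ p $ i = (if k = i then 1 else 0)" for k
      proof -
        have "(\<Sum>m\<in>UNIV. S $ k $ m * J $ m $ i) = (\<Sum>m\<in>{i, p}. S $ k $ m * J $ m $ i)"
          by (rule sum.mono_neutral_right) (auto simp: Ji0)
        then show ?thesis using inv_nth[of k i] pne by (simp add: a_def)
      qed
      have Jpi: "J $ p $ i = - \<rho> * a"
      proof -
        have "s * (\<rho> * a + J $ p $ i) = 0"
          using two[of p] pne Sip symS[of p i] diag[of p] by (simp add: algebra_simps)
        then show ?thesis using s by simp
      qed
      have as: "a * (s * (1 - \<rho>\<^sup>2)) = 1"
        using two[of i] Sip diag[of i] Jpi by (simp add: algebra_simps power2_eq_square)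
      then have a0: "a \<noteq> 0" and r1: "1 - \<rho>\<^sup>2 \<noteq> 0" by auto
      have row: "S $ i $ k = \<rho> * S $ p $ k" if "k \<noteq> i" for k
        using two[of k] that a0 symS[of k i] symS[of k p] by (simp add: Jpi algebra_simps)
      have Ji: "J $ i $ l = a * w $ l" for l
        using Ji0[of l] Jpi symJ[of i l] by (simp add: w_nth a_def)
      have K_i: "K $ i $ l = (if l = i then 1 / s else 0)" for l
        by (simp add: K_def Ji w_nth axis_def)
      have symK: "K $ k $ l = K $ l $ k" for k l by (simp add: K_def symJ[of k l] mult.commute)
      have symT: "T $ k $ l = T $ l $ k" for k l by (simp add: T_def symS[of k l])
      \<comment> \<open>For \<open>k \<noteq> i\<close>, row \<open>k\<close> of
        \<open>T ** K\<close> differs from that of \<open>S ** J\<close> by a loss at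
        \<open>m = i\<close> and a gain at \<open>m = p\<close>; the two cancel by
        \<open>row\<close>.\<close>
      have TK: "T ** K = mat 1"
      proof -
        have "(\<Sum>m\<in>UNIV. T $ k $ m * K $ m $ l) = (if k = l then 1 else 0)" for k l
        proof (cases "k = i")
          case True
          then have "(\<Sum>m\<in>UNIV. T $ k $ m * K $ m $ l) = (\<Sum>m\<in>UNIV. if m = i then s * K $ i $ l else 0)"
            by (intro sum.cong) (auto simp: T_def)
          then show ?thesis using True s by (simp add: K_i)
        next
          case False
          have "T $ k $ m * K $ m $ l = S $ k $ m * J $ m $ l
              + (if m = i then - S $ k $ i * J $ i $ l else 0)
              + (if m = p then S $ k $ p * \<rho> * a * w $ l else 0)" for m
            using False pne by (auto simp: T_def K_def w_nth[of m] axis_def algebra_simps)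
          then have "(\<Sum>m\<in>UNIV. T $ k $ m * K $ m $ l) =
              (\<Sum>m\<in>UNIV. S $ k $ m * J $ m $ l) - S $ k $ i * J $ i $ l + S $ k $ p * \<rho> * a * w $ l"
            by (simp add: sum.distrib)
          also have "\<dots> = (if k = l then 1 else 0)"
            using inv_nth[of k l] row[OF False] symS[of k i] symS[of k p] by (simp add: Ji)
          finally show ?thesis .
        qed
        then show ?thesis by (simp add: vec_eq_iff matrix_matrix_mult_def mat_def)
      qed
      \<comment> \<open>There is no fill-in: outside row and column \<open>i\<close> the update
        alters only the diagonal entry at \<open>p\<close>.\<close>
      have K_sparse: "(k, l) \<in> E \<and> k \<in> V - {i} \<and> l \<in> V - {i}" if "k \<noteq> l" "K $ k $ l \<noteq> 0" for k l
      proof -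
        have ne: "k \<noteq> i" "l \<noteq> i" using that K_i symK[of k l] by auto
        then have "J $ k $ l \<noteq> 0" using that by (auto simp: K_def w_nth axis_def split: if_splits)
        then show ?thesis using sparse that ne by auto
      qed
      have IH: "y \<bullet> (K *v y) = (\<Sum>k\<in>UNIV. (y $ k)\<^sup>2 / s) + (\<Sum>(k, l)\<in>edges_on E (V - {i}).
          (r k l)\<^sup>2 / (1 - (r k l)\<^sup>2) * (((y $ k)\<^sup>2 + (y $ l)\<^sup>2) / s) -
          2 * r k l / (1 - (r k l)\<^sup>2) * (y $ k * y $ l / s))
        \<and> det T = s ^ CARD('n) * (\<Prod>(k, l)\<in>edges_on E (V - {i}). 1 - (r k l)\<^sup>2)"
        using edge by (intro less.hyps[OF card symT symK TK _ _ K_sparse]) (auto simp: T_def diag)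
      note edges = edges_on_remove_leaf[OF symE irr iV pV ipE ip]
      have fin: "finite (edges_on E (V - {i}))" by simp
      have rm: "r (min i p) (max i p) = \<rho>" by (simp add: \<rho>_def min_def max_def symr)
      have ym: "(y $ min i p)\<^sup>2 + (y $ max i p)\<^sup>2 = (y $ i)\<^sup>2 + (y $ p)\<^sup>2"
        "y $ min i p * y $ max i p = y $ i * y $ p"
        by (simp_all add: min_def max_def)
      have a_eq: "a = 1 / (s * (1 - \<rho>\<^sup>2))" using as s r1 by (simp add: field_simps)
      \<comment> \<open>The form of \<open>K\<close> already contains
        \<open>(y $ i)\<^sup>2 / s\<close>, so the edge term is
        \<open>a * (y $ i - \<rho> * y $ p)\<^sup>2\<close> minus this square.\<close>
      have "y \<bullet> (J *v y) = y \<bullet> (K *v y) + a * (y \<bullet> w)\<^sup>2 - 1 / s * (y $ i)\<^sup>2"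
        by (rule quadratic_form_rank_one_update) (simp add: K_def)
      also have "y \<bullet> w = y $ i - \<rho> * y $ p" by (simp add: w_def inner_diff_right inner_axis)
      finally have "y \<bullet> (J *v y) = y \<bullet> (K *v y) + (\<rho>\<^sup>2 / (1 - \<rho>\<^sup>2) * (((y $ i)\<^sup>2 + (y $ p)\<^sup>2) / s) -
          2 * \<rho> / (1 - \<rho>\<^sup>2) * (y $ i * y $ p / s))"
        unfolding a_eq using s r1 by (simp add: divide_simps) (simp add: power2_eq_square algebra_simps)
      moreover have "det S = (1 - \<rho>\<^sup>2) * det T"
        using pne symS row diag Sip by (intro det_eliminate_row_column) (auto simp: T_def)
      ultimately show ?thesis
        using IH by (simp add: edges rm ym)
    qed
  qed
qed

subsection \<open>Nearest-neighbour graphs\<close>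

lemma nn_props:
  fixes x :: "'n::finite \<Rightarrow> 'a::metric_space"
  assumes "CARD('n) \<ge> 2"
  shows nn_neq: "nn x i \<noteq> i"
    and dist_nn_le: "j \<noteq> i \<Longrightarrow> dist (x i) (x (nn x i)) \<le> dist (x i) (x j)"
proof -
  have ne: "UNIV - {i} \<noteq> {}"
  proof
    assume "UNIV - {i} = {}"
    then have "UNIV = {i}" by auto
    then have "CARD('n) = card {i}" by metis
    then show False using assms by simp
  qed
  show "nn x i \<noteq> i"
    using arg_min_if_finite(1)[OF _ ne, of "\<lambda>j. dist (x i) (x j)"] by (simp add: nn_def)
  show "dist (x i) (x (nn x i)) \<le> dist (x i) (x j)" if "j \<noteq> i"
    unfolding nn_def using ne that by (intro arg_min_least) auto
qed

lemma nng_leaf: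
  fixes x :: "'n::finite \<Rightarrow> 'a::metric_space"
  assumes "CARD('n) \<ge> 2" and "distinct_distances x" and "W \<noteq> {}"
  shows "\<exists>i\<in>W. \<exists>p. \<forall>j\<in>W. (i, j) \<in> nng_edges x \<longrightarrow> j = p"
proof -
  define d where "d i = dist (x i) (x (nn x i))" for i
  have "finite (d ` W)" "d ` W \<noteq> {}" using assms(3) by auto
  then obtain i where i: "i \<in> W" "d i = Max (d ` W)" using Max_in by (metis imageE)
  have max: "d j \<le> d i" if "j \<in> W" for j using i that by simp
  \<comment> \<open>The only possible neighbour in \<open>W\<close> is \<open>nn x i\<close>. Any
    other \<open>j\<close> would point to \<open>i\<close>, giving
    \<open>d i \<le> dist (x i) (x j) = d j \<le> d i\<close>, a tie between two different
    pairs.\<close>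
  have "j = nn x i" if "j \<in> W" "(i, j) \<in> nng_edges x" for j
  proof (rule ccontr)
    assume ne: "j \<noteq> nn x i"
    then have ij: "nn x j = i" using that by (auto simp: nng_edges_def)
    then have "j \<noteq> i" using nn_neq[OF assms(1)] by metis
    then have "d i \<le> dist (x i) (x j)" unfolding d_def by (rule dist_nn_le[OF assms(1)])
    moreover have "d j = dist (x i) (x j)" by (simp add: d_def ij dist_commute)
    ultimately have eq: "dist (x i) (x (nn x i)) = dist (x i) (x j)"
      using max[OF that(1)] by (simp add: d_def)
    have "nn x i \<noteq> i" by (rule nn_neq[OF assms(1)])
    then have "{i, nn x i} \<noteq> {i, j}" using ne by (auto simp: doubleton_eq_iff)
    then show False
      using assms(2) eq \<open>nn x i \<noteq> i\<close> \<open>j \<noteq> i\<close> unfolding distinct_distances_def by metis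
  qed
  then show ?thesis using i(1) by blast
qed

subsection \<open>Conditional independence and kernels\<close>

text \<open>Change of variables for conditional expectations. Each event of the sigma-algebra on
  \<open>M\<close> is the \<open>Y\<close>-preimage of one on the image space, so the set integrals
  that characterise both sides agree.\<close>

lemma real_cond_exp_vimage:
  assumes prob: "prob_space M" and Y[measurable]: "Y \<in> measurable M N" and X[measurable]: "X \<in> measurable N L"
    and phi[measurable]: "\<phi> \<in> borel_measurable N" and int: "integrable (distr M N Y) \<phi>"
  shows "AE \<omega> in M. real_cond_exp M (vimage_algebra (space M) (\<lambda>\<omega>. X (Y \<omega>)) L) (\<lambda>\<omega>. \<phi> (Y \<omega>)) \<omega> =
    real_cond_exp (distr M N Y) (vimage_algebra (space N) X L) \<phi> (Y \<omega>)"
proof -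
  let ?F = "vimage_algebra (space M) (\<lambda>\<omega>. X (Y \<omega>)) L" and ?F' = "vimage_algebra (space N) X L"
  let ?N = "distr M N Y"
  have subF: "subalgebra M ?F"
    unfolding subalgebra_def using sets_image_in_sets[of M "space M" "\<lambda>\<omega>. X (Y \<omega>)" L] by simp
  have subF': "subalgebra ?N ?F'"
    unfolding subalgebra_def using sets_image_in_sets[of N "space N" X L] by simp
  interpret M: finite_measure_subalgebra M ?F
    using prob subF by (simp add: finite_measure_subalgebra_def finite_measure_subalgebra_axioms_def prob_space.finite_measure)
  interpret PN: prob_space ?N by (rule prob_space.prob_space_distr[OF prob Y])
  interpret N: finite_measure_subalgebra ?N ?F'
    using subF' by (simp add: finite_measure_subalgebra_def finite_measure_subalgebra_axioms_def PN.finite_measure_axioms)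
  have YF: "Y \<in> measurable ?F ?F'"
  proof (rule measurable_vimage_algebra2)
    show "Y \<in> space ?F \<rightarrow> space N" using measurable_space[OF Y] by auto
    show "(\<lambda>x. X (Y x)) \<in> measurable ?F L"
      by (rule measurable_vimage_algebra1) (use measurable_space[OF Y] measurable_space[OF X] in auto)
  qed
  have X_space: "X \<in> space N \<rightarrow> space L" "(\<lambda>\<omega>. X (Y \<omega>)) \<in> space M \<rightarrow> space L"
    using measurable_space[OF X] measurable_space[OF Y] by auto
  have ce[measurable]: "real_cond_exp ?N ?F' \<phi> \<in> borel_measurable N"
    using borel_measurable_cond_exp2[of ?N ?F' \<phi>] by simp
  show ?thesis
  proof (rule M.real_cond_exp_charact)
    fix A assume "A \<in> sets ?F"
    then obtain B where B: "B \<in> sets L" "A = (\<lambda>\<omega>. X (Y \<omega>)) -` B \<inter> space M"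
      using X_space by (auto simp: sets_vimage_algebra2)
    define A' where "A' = X -` B \<inter> space N"
    have A': "A' \<in> sets ?F'" using B(1) by (auto simp: A'_def intro: in_vimage_algebra)
    then have A'N[measurable]: "A' \<in> sets N" using subF' by (auto simp: subalgebra_def)
    have ind: "indicator A \<omega> = (indicator A' (Y \<omega>) :: real)" if "\<omega> \<in> space M" for \<omega>
      using that measurable_space[OF Y] by (auto simp: B A'_def indicator_def)
    have "(\<integral>\<omega>\<in>A. h (Y \<omega>) \<partial>M) = (\<integral>y\<in>A'. h y \<partial>?N)" if [measurable]: "h \<in> borel_measurable N" for h :: "_ \<Rightarrow> real"
      unfolding set_lebesgue_integral_def by (subst integral_distr) (auto intro!: Bochner_Integration.integral_cong simp: ind)
    then show "(\<integral>\<omega>\<in>A. \<phi> (Y \<omega>) \<partial>M) = (\<integral>\<omega>\<in>A. real_cond_exp ?N ?F' \<phi> (Y \<omega>) \<partial>M)"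
      using N.real_cond_exp_intA[OF int A'] by simp
  next
    show "integrable M (\<lambda>\<omega>. \<phi> (Y \<omega>))" using int by (subst (asm) integrable_distr_eq) auto
    show "integrable M (\<lambda>\<omega>. real_cond_exp ?N ?F' \<phi> (Y \<omega>))"
      using N.real_cond_exp_int(1)[OF int] by (subst (asm) integrable_distr_eq) auto
    show "(\<lambda>\<omega>. real_cond_exp ?N ?F' \<phi> (Y \<omega>)) \<in> borel_measurable ?F"
      by (rule measurable_compose[OF YF borel_measurable_cond_exp])
  qed
qed

text \<open>Moves the Markov property from an unspecified sample space to the law of
  \<open>Y\<close>, where coordinates can be shifted and integrals written with a density.\<close>

lemma cond_indep_var_distr:
  fixes Y :: "'w \<Rightarrow> real^'n"
  assumes prob: "prob_space M" and Y[measurable]: "Y \<in> borel_measurable M"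
    and ci: "cond_indep_var M (coord_algebra M Y K) (\<lambda>\<omega>. Y \<omega> $ i) (\<lambda>\<omega>. Y \<omega> $ j)"
  shows "cond_indep_var (distr M borel Y) (coord_algebra (distr M borel Y) (\<lambda>y. y) K) (\<lambda>y. y $ i) (\<lambda>y. y $ j)"
  unfolding cond_indep_var_def
proof (intro ballI)
  fix A B :: "real set" assume [measurable]: "A \<in> sets borel" "B \<in> sets borel"
  let ?N = "distr M borel Y"
  interpret N: prob_space ?N by (rule prob_space.prob_space_distr[OF prob Y])
  let ?F = "coord_algebra M Y K" and ?F' = "coord_algebra ?N (\<lambda>y. y) K"
  have X: "(\<lambda>y::real^'n. \<lambda>k\<in>K. y $ k) \<in> measurable borel (\<Pi>\<^sub>M k\<in>K. borel)" by measurable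
  have *: "AE \<omega> in M. real_cond_exp M ?F (\<lambda>\<omega>. \<phi> (Y \<omega>)) \<omega> = real_cond_exp ?N ?F' \<phi> (Y \<omega>)"
    if [measurable]: "\<phi> \<in> borel_measurable borel" and b: "\<And>y. \<bar>\<phi> y\<bar> \<le> 1" for \<phi> :: "real^'n \<Rightarrow> real"
  proof -
    have "integrable ?N \<phi>" using b by (intro N.integrable_const_bound[where B=1]) auto
    from real_cond_exp_vimage[OF prob Y X that(1) this] show ?thesis
      by (simp add: coord_algebra_def)
  qed
  have [measurable]: "real_cond_exp ?N ?F' \<phi> \<in> borel_measurable borel" for \<phi>
    using borel_measurable_cond_exp2[of ?N ?F' \<phi>] by simp
  have ind_le: "\<bar>indicator A (y $ i) * indicator B (y $ j) :: real\<bar> \<le> 1"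
    "\<bar>indicator A (y $ i) :: real\<bar> \<le> 1" "\<bar>indicator B (y $ j) :: real\<bar> \<le> 1" for y :: "real^'n"
    by (auto simp: indicator_def)
  have "AE \<omega> in M. real_cond_exp ?N ?F' (\<lambda>y. indicator A (y $ i) * indicator B (y $ j)) (Y \<omega>) =
        real_cond_exp ?N ?F' (\<lambda>y. indicator A (y $ i)) (Y \<omega>) *
        real_cond_exp ?N ?F' (\<lambda>y. indicator B (y $ j)) (Y \<omega>)"
    using ci[unfolded cond_indep_var_def, rule_format, OF \<open>A \<in> sets borel\<close> \<open>B \<in> sets borel\<close>]
      *[of "\<lambda>y. indicator A (y $ i) * indicator B (y $ j)", OF _ ind_le(1)]
      *[of "\<lambda>y. indicator A (y $ i)", OF _ ind_le(2)] *[of "\<lambda>y. indicator B (y $ j)", OF _ ind_le(3)]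
    by (auto simp del: abs_mult)
  then show "AE y in ?N. real_cond_exp ?N ?F' (\<lambda>y. indicator A (y $ i) * indicator B (y $ j)) y =
        real_cond_exp ?N ?F' (\<lambda>y. indicator A (y $ i)) y *
        real_cond_exp ?N ?F' (\<lambda>y. indicator B (y $ j)) y"
    by (subst AE_distr_iff) auto
qed

text \<open>Here \<open>m\<close> is a version of the conditional probability of \<open>y $ j \<in> B\<close> given the coordinates
  other than \<open>i\<close> and \<open>j\<close>; conditional independence makes it a version of the conditional
  probability given all coordinates other than \<open>j\<close>.\<close>

lemma cond_indep_kernel:
  fixes N :: "(real^'n) measure"
  assumes prob: "prob_space N" and sN[measurable_cong]: "sets N = sets borel" and ij: "i \<noteq> j"
    and ci: "cond_indep_var N (coord_algebra N (\<lambda>y. y) (- {i, j})) (\<lambda>y. y $ i) (\<lambda>y. y $ j)"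
    and B[measurable]: "B \<in> sets borel"
  obtains m :: "real^'n \<Rightarrow> real" where "m \<in> borel_measurable borel" "\<And>y. 0 \<le> m y" "\<And>y. m y \<le> 1"
    "\<And>y z. (\<And>k. k \<noteq> i \<Longrightarrow> k \<noteq> j \<Longrightarrow> y $ k = z $ k) \<Longrightarrow> m y = m z"
    "\<And>G. G \<in> borel_measurable borel \<Longrightarrow> (\<And>y z. (\<And>k. k \<noteq> j \<Longrightarrow> y $ k = z $ k) \<Longrightarrow> G y = G z) \<Longrightarrow>
      (\<integral>y. indicator B (y $ j) * G y \<partial>N) = (\<integral>y. m y * (G y :: real) \<partial>N)"
proof -
  interpret prob_space N by fact
  define X :: "real^'n \<Rightarrow> 'n \<Rightarrow> real" where "X y = (\<lambda>k\<in>-{i, j}. y $ k)" for y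
  let ?L = "\<Pi>\<^sub>M k\<in>-{i, j}. (borel :: real measure)"
  define F where "F = coord_algebra N (\<lambda>y. y) (- {i, j})"
  have spN: "space N = UNIV" using sets_eq_imp_space_eq[OF sN] by simp
  have X[measurable]: "X \<in> measurable borel ?L" unfolding X_def by measurable
  have X_space: "X \<in> UNIV \<rightarrow> space ?L" using measurable_space[OF X] by auto
  have F: "F = vimage_algebra UNIV X ?L" by (simp add: F_def coord_algebra_def spN X_def[abs_def])
  have setsF: "sets F = {X -` A | A. A \<in> sets ?L}" using X_space by (simp add: F sets_vimage_algebra2)
  have spF: "space F = UNIV" by (simp add: F)
  have subF: "subalgebra N F"
    using measurable_sets[OF X] by (auto simp: subalgebra_def spN F sets_vimage_algebra2 X_space sN)
  interpret N: finite_measure_subalgebra N F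
    using subF by (simp add: finite_measure_subalgebra_def finite_measure_subalgebra_axioms_def finite_measure_axioms)
  define m0 where "m0 = real_cond_exp N F (\<lambda>y. indicator B (y $ j))"
  \<comment> \<open>Clipping makes the bounds hold at every point; by \<open>m_eq\<close> it changes
    \<open>m0\<close> only on a null set.\<close>
  define m where "m y = max 0 (min 1 (m0 y))" for y
  have mF[measurable]: "m \<in> borel_measurable F" unfolding m_def m0_def by measurable
  have mb[measurable]: "m \<in> borel_measurable borel"
    using measurable_from_subalg[OF subF mF] measurable_cong_sets[OF sN refl] by blast
  have m01: "0 \<le> m y" "m y \<le> 1" for y by (auto simp: m_def)
  have intB: "integrable N (\<lambda>y. indicator B (y $ j) :: real)"
    by (rule integrable_const_bound[where B=1]) (auto simp: indicator_def)
  have m_eq: "AE y in N. real_cond_exp N F (\<lambda>y. indicator B (y $ j)) y = m y"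
    using N.real_cond_exp_ge_c[OF intB, of 0] N.real_cond_exp_le_c[OF intB, of 1]
    by (auto simp: m_def m0_def)
  \<comment> \<open>A set in \<open>F\<close> is an \<open>X\<close>-preimage and cannot separate
    points with the same \<open>X\<close>; this is applied to a level set of
    \<open>m\<close>.\<close>
  have m_inv: "m y = m z" if "\<And>k. k \<noteq> i \<Longrightarrow> k \<noteq> j \<Longrightarrow> y $ k = z $ k" for y z
  proof -
    have "m -` {m z} \<inter> space F \<in> sets F" by (rule measurable_sets[OF mF]) simp
    then obtain A where A: "m -` {m z} = X -` A" by (auto simp: setsF spF)
    have "X y = X z" using that by (auto simp: X_def restrict_def)
    then have "y \<in> X -` A \<longleftrightarrow> z \<in> X -` A" by simp
    then show ?thesis unfolding A[symmetric] by simp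
  qed
  \<comment> \<open>Condition on \<open>F\<close>, factor by conditional independence, replace the
    factor belonging to \<open>B\<close> by \<open>m\<close>, and undo the conditioning of the
    factor belonging to \<open>A\<close>.\<close>
  have rect: "(\<integral>y. indicator B (y $ j) * (indicator C y * indicator A (y $ i)) \<partial>N) =
      (\<integral>y. m y * (indicator C y * indicator A (y $ i)) \<partial>N)"
    if [measurable]: "A \<in> sets borel" and CF[measurable]: "C \<in> sets F" for A C
  proof -
    have CN[measurable]: "C \<in> sets borel" using subF CF by (auto simp: subalgebra_def sN)
    have "(\<integral>y. indicator B (y $ j) * (indicator C y * indicator A (y $ i)) \<partial>N) =
        (\<integral>y. (indicator C y :: real) * (indicator A (y $ i) * indicator B (y $ j)) \<partial>N)"
      by (intro Bochner_Integration.integral_cong) (auto simp: mult_ac)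
    also have "\<dots> = (\<integral>y. indicator C y * real_cond_exp N F (\<lambda>y. indicator A (y $ i) * indicator B (y $ j)) y \<partial>N)"
      by (rule N.real_cond_exp_intg(2)[symmetric])
        (auto intro!: integrable_const_bound[where B=1] simp: indicator_def)
    also have "\<dots> = (\<integral>y. indicator C y * m y * real_cond_exp N F (\<lambda>y. indicator A (y $ i)) y \<partial>N)"
    proof (rule integral_cong_AE)
      show "AE y in N. indicator C y * real_cond_exp N F (\<lambda>y. indicator A (y $ i) * indicator B (y $ j)) y =
          indicator C y * m y * real_cond_exp N F (\<lambda>y. indicator A (y $ i)) y"
        using ci[folded F_def, unfolded cond_indep_var_def, rule_format, of A B] m_eq by auto
    qed (auto)
    also have "\<dots> = (\<integral>y. indicator C y * m y * indicator A (y $ i) \<partial>N)"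
      by (rule N.real_cond_exp_intg(2))
        (auto intro!: integrable_const_bound[where B=1] simp: indicator_def m01)
    also have "\<dots> = (\<integral>y. m y * (indicator C y * indicator A (y $ i)) \<partial>N)"
      by (intro Bochner_Integration.integral_cong) (auto simp: mult_ac)
    finally show ?thesis .
  qed
  \<comment> \<open>\<open>P\<close> erases coordinate \<open>j\<close>, so a function
    \<open>G\<close> that ignores this coordinate satisfies \<open>G (P y) = G y\<close>. It is then
    enough that \<open>N\<close> weighted by the indicator and \<open>N\<close> weighted by
    \<open>m\<close> have the same image under \<open>P\<close>; boxes generate and are stable under
    intersection.\<close>
  define P :: "real^'n \<Rightarrow> real^'n" where "P y = y - (y $ j) *\<^sub>R axis j 1" for y
  have P_nth: "P y $ k = (if k = j then 0 else y $ k)" for y k by (simp add: P_def axis_def)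
  have P[measurable]: "P \<in> borel_measurable borel" unfolding P_def by measurable
  define \<mu> where "\<mu> h = distr (density N (\<lambda>y. ennreal (h y))) borel P" for h :: "real^'n \<Rightarrow> real"
  have box: "emeasure (\<mu> h) E = ennreal (\<integral>y. h y * indicator E (P y) \<partial>N)"
    if [measurable]: "h \<in> borel_measurable borel" "E \<in> sets borel" and h01: "\<And>y. 0 \<le> h y" "\<And>y. h y \<le> 1" for h E
  proof -
    have "emeasure (\<mu> h) E = (\<integral>\<^sup>+ y. ennreal (h y) * indicator (P -` E) y \<partial>N)"
      unfolding \<mu>_def using measurable_sets[OF P that(2)]
      by (subst emeasure_distr) (auto simp: spN emeasure_density sN)
    also have "\<dots> = (\<integral>\<^sup>+ y. ennreal (h y * indicator E (P y)) \<partial>N)"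
      by (intro nn_integral_cong) (auto simp: indicator_def)
    also have "\<dots> = ennreal (\<integral>y. h y * indicator E (P y) \<partial>N)"
      using h01 by (intro nn_integral_eq_integral integrable_const_bound[where B=1]) (auto simp: indicator_def)
    finally show ?thesis .
  qed
  have meq: "\<mu> (\<lambda>y. indicator B (y $ j)) = \<mu> m"
  proof (rule measure_eqI_generator_eq)
    let ?E = "range (\<lambda>(a, b). box a b :: (real^'n) set)"
    show "Int_stable ?E" by (auto simp: Int_stable_def box_Int_box)
    show "?E \<subseteq> Pow UNIV" by auto
    show "sets (\<mu> (\<lambda>y. indicator B (y $ j))) = sigma_sets UNIV ?E" "sets (\<mu> m) = sigma_sets UNIV ?E"
      by (simp_all add: \<mu>_def borel_eq_box)
    let ?A = "\<lambda>k::nat. box (- (real k *\<^sub>R One)) (real k *\<^sub>R One) :: (real^'n) set"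
    show "range ?A \<subseteq> ?E" by auto
    show "(\<Union>k. ?A k) = UNIV" by (rule UN_box_eq_UNIV)
    show "emeasure (\<mu> (\<lambda>y. indicator B (y $ j))) (?A k) \<noteq> \<infinity>" for k
      by (subst box) (auto simp: indicator_def)
    fix E assume "E \<in> ?E"
    then obtain a b where E: "E = box a b" by auto
    \<comment> \<open>Coordinate \<open>j\<close> of \<open>P y\<close> is 0, so the box is missed
      altogether unless its \<open>j\<close>-th side contains 0. Otherwise its preimage is an event
      of \<open>F\<close> together with an interval for coordinate \<open>i\<close>, as
      \<open>rect\<close> requires.\<close>
    define C where "C = (if a $ j < 0 \<and> 0 < b $ j then X -` (\<Pi>\<^sub>E k\<in>-{i, j}. {a $ k <..< b $ k}) else {})"
    have "X -` (\<Pi>\<^sub>E k\<in>-{i, j}. {a $ k <..< b $ k}) \<in> sets F"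
      unfolding setsF by (intro CollectI exI conjI refl sets_PiM_I_finite) auto
    then have C: "C \<in> sets F" by (auto simp: C_def)
    have "P y \<in> E \<longleftrightarrow> y \<in> C \<and> y $ i \<in> {a $ i <..< b $ i}" for y
      using ij by (auto simp: E C_def P_nth X_def mem_box_cart PiE_iff split: if_splits)
    then have "(indicator E (P y) :: real) = indicator C y * indicator {a $ i <..< b $ i} (y $ i)" for y
      by (auto simp: indicator_def)
    then show "emeasure (\<mu> (\<lambda>y. indicator B (y $ j))) E = emeasure (\<mu> m) E"
      using rect[OF _ C, of "{a $ i <..< b $ i}"] m01
      by (subst (1 2) box) (auto simp: E indicator_def)
  qed
  have "(\<integral>y. indicator B (y $ j) * G y \<partial>N) = (\<integral>y. m y * G y \<partial>N)"
    if [measurable]: "G \<in> borel_measurable borel" and inv: "\<And>y z. (\<And>k. k \<noteq> j \<Longrightarrow> y $ k = z $ k) \<Longrightarrow> G y = G z"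
    for G :: "real^'n \<Rightarrow> real"
  proof -
    have GP: "G (P y) = G y" for y by (rule inv) (simp add: P_nth)
    have "(\<integral>y. h y * G y \<partial>N) = (\<integral>y. G y \<partial>\<mu> h)"
      if [measurable]: "h \<in> borel_measurable borel" and "\<And>y. 0 \<le> h y" for h
      unfolding \<mu>_def using that by (subst integral_distr) (auto simp: integral_density GP)
    then show ?thesis using meq m01 by simp
  qed
  with that[OF mb m01 m_inv] show thesis by blast
qed

subsection \<open>Gaussian vectors and their precision matrices\<close>

lemma lborel_shift:
  fixes h :: "'a::euclidean_space \<Rightarrow> real"
  assumes [measurable]: "h \<in> borel_measurable borel"
  shows lborel_integral_shift: "(\<integral>y. h (v + y) \<partial>lborel) = (\<integral>y. h y \<partial>lborel)"
    and lborel_integrable_shift: "integrable lborel (\<lambda>y. h (v + y)) \<longleftrightarrow> integrable lborel h"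
proof -
  have "(\<integral>y. h (v + y) \<partial>lborel) = (\<integral>y. h y \<partial>distr lborel borel ((+) v))"
    by (subst integral_distr) auto
  then show "(\<integral>y. h (v + y) \<partial>lborel) = (\<integral>y. h y \<partial>lborel)" by (simp add: lborel_distr_plus)
  have "integrable lborel (\<lambda>y. h (v + y)) \<longleftrightarrow> integrable (distr lborel borel ((+) v)) h"
    by (subst integrable_distr_eq) auto
  then show "integrable lborel (\<lambda>y. h (v + y)) \<longleftrightarrow> integrable lborel h" by (simp add: lborel_distr_plus)
qed

lemma AE_lborel_shift:
  fixes v :: "'a::euclidean_space"
  assumes "AE y in lborel. Q y"
  shows "AE y in lborel. Q (v + y)"
  by (rule AE_distrD[of "(+) v" lborel borel]) (simp, subst lborel_distr_plus, rule assms)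

text \<open>The strip contains a cube of volume 1, so it is not a null set.\<close>

lemma AE_lborel_strip:
  fixes j :: "'n::finite"
  assumes ae: "AE y in lborel. \<not> (- 1 < y $ j \<and> y $ j < (0::real))"
  shows False
proof -
  let ?b = "box (\<chi> k. -1) (\<chi> k. 0) :: (real^'n) set"
  have "AE y in lborel. y \<notin> ?b" by (rule AE_mp[OF ae]) (auto simp: mem_box_cart)
  then have "emeasure lborel ?b = 0" using AE_iff_null_sets[of ?b lborel] by auto
  moreover have "emeasure lborel ?b = ennreal (\<Prod>b\<in>Basis. ((\<chi> k. 0) - (\<chi> k. -1)) \<bullet> (b :: real^'n))"
    by (rule emeasure_lborel_box) (auto simp: Basis_vec_def inner_axis)
  moreover have "(\<Prod>b\<in>Basis. ((\<chi> k. 0) - (\<chi> k. -1)) \<bullet> (b :: real^'n)) = 1"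
    by (intro prod.neutral) (auto simp: Basis_vec_def inner_axis)
  ultimately show False by simp
qed

lemma quadratic_form_shift:
  fixes y :: "real^'n" and J :: "real^'n^'n"
  assumes symJ: "\<And>k l. J $ k $ l = J $ l $ k"
  shows "(t *\<^sub>R axis i 1 + y) \<bullet> (J *v (t *\<^sub>R axis i 1 + y)) =
    y \<bullet> (J *v y) + 2 * t * (J *v y) $ i + t\<^sup>2 * J $ i $ i"
proof -
  have "transpose J = J" using symJ by (simp add: vec_eq_iff transpose_def)
  then have s: "y \<bullet> (J *v axis i 1) = (J *v y) $ i"
    using dot_lmul_matrix[of y J "axis i 1"] transpose_matrix_vector[of J y] by (simp add: inner_axis)
  have a: "axis i 1 \<bullet> (J *v y) = (J *v y) $ i" "axis i 1 \<bullet> (J *v axis i 1) = J $ i $ i"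
    by (simp_all add: inner_axis' matrix_vector_mult_basis column_def)
  show ?thesis
    by (simp add: matrix_vector_right_distrib matrix_vector_mult_scaleR inner_add_left inner_add_right s a
        power2_eq_square algebra_simps)
qed

text \<open>If \<open>J $ i $ j = c \<noteq> 0\<close>, shifting \<open>y $ i\<close> by \<open>- 1 / c\<close> multiplies the density by
  \<open>exp (y $ j)\<close> times a function of the other coordinates. As the kernel \<open>m\<close> does not see this
  shift, the conditional covariance of \<open>exp (y $ j)\<close> and the indicator of \<open>y $ j > 0\<close> vanishes.
  It is the integral of a nonnegative function, so \<open>y $ j > 0\<close> would be determined by the
  other coordinates.\<close>

lemma gaussian_cond_indep_precision:
  fixes J :: "real^'n^'n" and c0 :: real
  defines "f \<equiv> \<lambda>y. c0 * exp (- (y \<bullet> (J *v y)) / 2)"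
  defines "N \<equiv> density lborel (\<lambda>y. ennreal (f y))"
  assumes prob: "prob_space N" and ij: "i \<noteq> j"
    and symJ: "\<And>k l. J $ k $ l = J $ l $ k"
    and ci: "cond_indep_var N (coord_algebra N (\<lambda>y. y) (- {i, j})) (\<lambda>y. y $ i) (\<lambda>y. y $ j)"
  shows "J $ i $ j = 0"
proof (rule ccontr)
  define c where "c = J $ i $ j"
  assume "J $ i $ j \<noteq> 0"
  then have c: "c \<noteq> 0" by (simp add: c_def)
  \<comment> \<open>Otherwise \<open>ennreal\<close> truncates the density to 0 and the total mass
    is not 1.\<close>
  have c0: "c0 > 0"
  proof (rule ccontr)
    assume "\<not> c0 > 0"
    then have "ennreal (f y) = 0" for y by (simp add: f_def ennreal_neg mult_nonpos_nonneg)
    then show False using prob_space.emeasure_space_1[OF prob] by (simp add: N_def emeasure_density)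
  qed
  have f_pos: "f y > 0" for y using c0 by (simp add: f_def)
  have [measurable]: "(\<lambda>y. J *v y) \<in> borel_measurable borel"
    by (rule borel_measurable_continuous_onI[OF linear_continuous_on[OF matrix_vector_mul_bounded_linear]])
  have [measurable]: "(\<lambda>y. (J *v y) $ k) \<in> borel_measurable borel" for k
    by (intro borel_measurable_continuous_onI continuous_intros)
  have fm[measurable]: "f \<in> borel_measurable borel" unfolding f_def by measurable
  have sN: "sets N = sets borel" by (simp add: N_def)
  define \<psi> :: "real^'n \<Rightarrow> real" where "\<psi> y = indicator {0<..} (y $ j)" for y
  have \<psi>m[measurable]: "\<psi> \<in> borel_measurable borel" unfolding \<psi>_def by measurable
  have pos: "{0::real<..} \<in> sets borel" by simp
  obtain m :: "real^'n \<Rightarrow> real" where mm[measurable]: "m \<in> borel_measurable borel"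
    and m01: "\<And>y. 0 \<le> m y" "\<And>y. m y \<le> 1"
    and m_inv: "\<And>y z. (\<And>k. k \<noteq> i \<Longrightarrow> k \<noteq> j \<Longrightarrow> y $ k = z $ k) \<Longrightarrow> m y = m z"
    and m_int: "\<And>G. G \<in> borel_measurable borel \<Longrightarrow> (\<And>y z. (\<And>k. k \<noteq> j \<Longrightarrow> y $ k = z $ k) \<Longrightarrow> G y = G z) \<Longrightarrow>
      (\<integral>y. indicator {0<..} (y $ j) * G y \<partial>N) = (\<integral>y. m y * (G y :: real) \<partial>N)"
    using cond_indep_kernel[OF prob sN ij ci pos] by blast
  have intf: "integrable lborel f"
  proof (rule integrableI_nonneg)
    show "(\<integral>\<^sup>+ y. ennreal (f y) \<partial>lborel) < \<infinity>"
      using prob_space.emeasure_space_1[OF prob] by (simp add: N_def emeasure_density)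
  qed (use f_pos in \<open>auto intro: less_imp_le\<close>)
  have int_bd: "integrable lborel (\<lambda>y. h y * f y)"
    if [measurable]: "h \<in> borel_measurable borel" and "\<And>y. 0 \<le> h y" "\<And>y. h y \<le> 1" for h :: "real^'n \<Rightarrow> real"
    by (rule Bochner_Integration.integrable_bound[OF intf])
      (use that f_pos in \<open>auto simp: abs_mult less_imp_le intro!: mult_left_le_one_le\<close>)
  have key: "(\<integral>y. \<psi> y * G y * f y \<partial>lborel) = (\<integral>y. m y * G y * f y \<partial>lborel)"
    if [measurable]: "G \<in> borel_measurable borel"
      and "\<And>y z. (\<And>k. k \<noteq> j \<Longrightarrow> y $ k = z $ k) \<Longrightarrow> G y = G z" for G :: "real^'n \<Rightarrow> real"
  proof -
    have "(\<integral>y. h y * G y \<partial>N) = (\<integral>y. h y * G y * f y \<partial>lborel)"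
      if [measurable]: "h \<in> borel_measurable borel" for h
      unfolding N_def by (subst integral_density) (auto simp: less_imp_le f_pos mult_ac)
    then show ?thesis using m_int[OF that] by (simp add: \<psi>_def)
  qed
  \<comment> \<open>The shift adds \<open>- t * c * y $ j\<close> to the exponent of
    \<open>f\<close>; this \<open>t\<close> makes it \<open>y $ j\<close>. \<open>E1\<close>
    collects the remaining new factors, which may depend on \<open>y $ i\<close> but not on
    \<open>y $ j\<close>.\<close>
  define t where "t = - 1 / c"
  define v :: "real^'n" where "v = t *\<^sub>R axis i 1"
  define E1 where "E1 y = exp (- t * ((J *v y) $ i - c * y $ j) - t\<^sup>2 * J $ i $ i / 2)" for y
  have E1m[measurable]: "E1 \<in> borel_measurable borel" unfolding E1_def by measurable
  have fv: "f (v + y) = f y * exp (y $ j) * E1 y" for y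
    unfolding f_def E1_def v_def quadratic_form_shift[OF symJ] mult.assoc exp_add[symmetric]
    using c by (simp add: t_def field_simps)
  have E1_inv: "E1 y = E1 z" if "\<And>k. k \<noteq> j \<Longrightarrow> y $ k = z $ k" for y z
  proof -
    have "(J *v y) $ i - c * y $ j = (\<Sum>k\<in>UNIV - {j}. J $ i $ k * y $ k)" for y
      by (simp add: matrix_vector_mult_def c_def sum.remove[of UNIV j])
    then show ?thesis using that by (simp add: E1_def)
  qed
  \<comment> \<open>Both weights lie between 0 and 1, so the integrals below exist without any
    exponential moment. Neither depends on \<open>y $ j\<close>, so \<open>key\<close> applies to
    \<open>G\<close> and to the translate of \<open>H\<close>; by \<open>Hf\<close> the shift turns
    that translate into \<open>G y * exp (y $ j)\<close>.\<close>
  define G where "G y = min 1 (E1 y)" for y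
  define H where "H y = G y / E1 y" for y
  have E1p: "E1 y > 0" for y by (simp add: E1_def)
  have Gm[measurable]: "G \<in> borel_measurable borel" unfolding G_def by measurable
  have Hm[measurable]: "H \<in> borel_measurable borel" unfolding H_def by measurable
  have G01: "0 < G y" "G y \<le> 1" and H01: "0 < H y" "H y \<le> 1" for y
    using E1p[of y] by (auto simp: G_def H_def)
  have G_inv: "G y = G z" and H_inv: "H y = H z" if "\<And>k. k \<noteq> j \<Longrightarrow> y $ k = z $ k" for y z
    using E1_inv[OF that] by (auto simp: G_def H_def)
  have v0: "v $ k = 0" if "k \<noteq> i" for k using that by (simp add: v_def axis_def)
  have mv: "m (v + y) = m y" for y by (rule m_inv) (simp add: v0)
  have \<psi>v: "\<psi> (v + y) = \<psi> y" for y using ij by (simp add: \<psi>_def v0)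
  have \<psi>01: "0 \<le> \<psi> y" "\<psi> y \<le> 1" for y by (auto simp: \<psi>_def indicator_def)
  have Hf: "H y * f (v + y) = G y * exp (y $ j) * f y" for y
    using E1p[of y] by (simp add: fv H_def field_simps)
  have shifted: "(\<integral>y. \<phi> y * (G y * exp (y $ j)) * f y \<partial>lborel) = (\<integral>y. \<phi> y * H (y - v) * f y \<partial>lborel)"
      "integrable lborel (\<lambda>y. \<phi> y * (G y * exp (y $ j)) * f y)"
    if [measurable]: "\<phi> \<in> borel_measurable borel" and "\<And>y. \<phi> (v + y) = \<phi> y"
      and \<phi>01: "\<And>y. 0 \<le> \<phi> y" "\<And>y. \<phi> y \<le> 1" for \<phi>
  proof -
    let ?h = "\<lambda>y. \<phi> y * H (y - v) * f y"
    have h: "?h (v + y) = \<phi> y * (G y * exp (y $ j)) * f y" for y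
      using Hf[of y] by (simp add: that(2) mult.assoc)
    have [measurable]: "?h \<in> borel_measurable borel" by measurable
    show "(\<integral>y. \<phi> y * (G y * exp (y $ j)) * f y \<partial>lborel) = (\<integral>y. ?h y \<partial>lborel)"
      using lborel_integral_shift[of ?h v] unfolding h by simp
    have "integrable lborel ?h"
      using \<phi>01 H01 by (intro int_bd) (auto simp: less_imp_le intro!: mult_le_one)
    then show "integrable lborel (\<lambda>y. \<phi> y * (G y * exp (y $ j)) * f y)"
      using lborel_integrable_shift[of ?h v] unfolding h by simp
  qed
  have intG: "integrable lborel (\<lambda>y. \<phi> y * G y * f y)"
    if [measurable]: "\<phi> \<in> borel_measurable borel" and \<phi>01: "\<And>y. 0 \<le> \<phi> y" "\<And>y. \<phi> y \<le> 1" for \<phi>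
    using \<phi>01 G01 by (intro int_bd) (auto simp: less_imp_le intro!: mult_le_one)
  have H_shift_inv: "H (y - v) = H (z - v)" if "\<And>k. k \<noteq> j \<Longrightarrow> y $ k = z $ k" for y z
    by (rule H_inv) (use that in simp)
  \<comment> \<open>Its integral is 0 by \<open>eqG\<close> and \<open>eqH\<close>. Pointwise it is
    nonnegative: \<open>\<psi> y - m y\<close> and \<open>exp (y $ j) - 1\<close> are both at least
    0 if \<open>0 < y $ j\<close> and both at most 0 otherwise.\<close>
  define D where "D y = (\<psi> y - m y) * (exp (y $ j) - 1) * (G y * f y)" for y
  have D_eq: "D y = \<psi> y * (G y * exp (y $ j)) * f y - m y * (G y * exp (y $ j)) * f y
      - (\<psi> y * G y * f y - m y * G y * f y)" for y
    by (simp add: D_def algebra_simps)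
  note ints = shifted(2)[OF \<psi>m \<psi>v \<psi>01] shifted(2)[OF mm mv m01] intG[OF \<psi>m \<psi>01] intG[OF mm m01]
  have D_int: "integrable lborel D"
    unfolding D_eq[abs_def] by (intro Bochner_Integration.integrable_diff ints)
  have eqG: "(\<integral>y. \<psi> y * G y * f y \<partial>lborel) = (\<integral>y. m y * G y * f y \<partial>lborel)"
    by (rule key[OF Gm G_inv])
  have eqH: "(\<integral>y. \<psi> y * H (y - v) * f y \<partial>lborel) = (\<integral>y. m y * H (y - v) * f y \<partial>lborel)"
    by (rule key[OF _ H_shift_inv]) measurable
  have "(\<integral>y. D y \<partial>lborel) = (\<integral>y. \<psi> y * (G y * exp (y $ j)) * f y \<partial>lborel)
      - (\<integral>y. m y * (G y * exp (y $ j)) * f y \<partial>lborel)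
      - ((\<integral>y. \<psi> y * G y * f y \<partial>lborel) - (\<integral>y. m y * G y * f y \<partial>lborel))"
    unfolding D_eq by (simp only: Bochner_Integration.integral_diff Bochner_Integration.integrable_diff ints)
  then have "(\<integral>y. D y \<partial>lborel) = 0"
    unfolding shifted(1)[OF \<psi>m \<psi>v \<psi>01] shifted(1)[OF mm mv m01] eqG eqH by simp
  moreover have "0 \<le> D y" for y
  proof -
    have *: "0 \<le> (\<psi> y - m y) * (exp (y $ j) - 1)"
      using m01[of y] by (cases "0 < y $ j") (auto simp: \<psi>_def intro: mult_nonneg_nonneg mult_nonneg_nonpos)
    show ?thesis
      unfolding D_def by (rule mult_nonneg_nonneg[OF *]) (simp add: G01 f_pos less_imp_le)
  qed
  ultimately have "AE y in lborel. D y = 0"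
    using integral_nonneg_eq_0_iff_AE[OF D_int] by simp
  then have ae: "AE y in lborel. (0 < y $ j \<longrightarrow> m y = 1) \<and> (y $ j < 0 \<longrightarrow> m y = 0)"
  proof eventually_elim
    case (elim y)
    then have "\<psi> y = m y \<or> y $ j = 0" using G01[of y] f_pos[of y] by (auto simp: D_def)
    then show ?case by (auto simp: \<psi>_def)
  qed
  \<comment> \<open>As \<open>m\<close> ignores coordinate \<open>j\<close>, moving \<open>y\<close>
    by 1 in that direction gives \<open>m y = 1\<close> almost everywhere on
    \<open>- 1 < y $ j\<close>. This clashes with \<open>m y = 0\<close> on the part where
    \<open>y $ j < 0\<close>.\<close>
  have m_j: "m (axis j 1 + y) = m y" for y by (rule m_inv) (simp add: axis_def)
  have "AE y in lborel. 0 < 1 + y $ j \<longrightarrow> m y = 1"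
    using AE_lborel_shift[OF ae, of "axis j 1"] by eventually_elim (auto simp: m_j)
  with ae have "AE y in lborel. \<not> (- 1 < y $ j \<and> y $ j < (0::real))" by eventually_elim auto
  then show False by (rule AE_lborel_strip)
qed

section \<open>Positive definite matrices and the zeros of the precision matrix\<close>

lemma invertible_matrix_inv:
  fixes A :: "real^'n^'n"
  assumes "invertible A"
  shows "A ** matrix_inv A = mat 1" "matrix_inv A ** A = mat 1"
  using someI_ex[OF assms[unfolded invertible_def]] by (simp_all add: matrix_inv_def)

lemma matrix_inv_eqI:
  fixes A B :: "real^'n^'n"
  assumes "A ** B = mat 1" "B ** A = mat 1"
  shows "matrix_inv A = B"
proof -
  have "invertible A" using assms by (auto simp: invertible_def)
  have "matrix_inv A = matrix_inv A ** (A ** B)" using assms by simp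
  also have "\<dots> = B" using invertible_matrix_inv(2)[OF \<open>invertible A\<close>] by (simp add: matrix_mul_assoc)
  finally show ?thesis .
qed

lemma pos_def_invertible:
  fixes A :: "real^'n^'n"
  assumes "pos_def A"
  shows "A ** matrix_inv A = mat 1" "matrix_inv A ** A = mat 1"
proof -
  have "v = 0" if "A *v v = 0" for v
    using assms that unfolding pos_def_def by (metis inner_zero_right less_irrefl)
  then have "invertible A"
    by (simp add: invertible_left_inverse matrix_left_invertible_ker)
  then show "A ** matrix_inv A = mat 1" "matrix_inv A ** A = mat 1"
    by (rule invertible_matrix_inv)+
qed

lemma symmetric_matrix_nth:
  assumes "transpose A = A"
  shows "A $ k $ l = A $ l $ k"
proof -
  have "transpose A $ k $ l = A $ l $ k" by (simp add: transpose_def)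
  then show ?thesis by (simp add: assms)
qed

lemma transpose_matrix_inv_pos_def:
  fixes A :: "real^'n^'n"
  assumes "pos_def A"
  shows "transpose (matrix_inv A) = matrix_inv A"
proof -
  note inv = pos_def_invertible[OF assms]
  have "transpose A = A" using assms by (simp add: pos_def_def)
  with inv[THEN arg_cong[where f = transpose]]
  have "A ** transpose (matrix_inv A) = mat 1" "transpose (matrix_inv A) ** A = mat 1"
    by (simp_all add: matrix_transpose_mul)
  then show ?thesis by (rule matrix_inv_eqI[symmetric])
qed

text \<open>Testing positive definiteness on the \<open>i\<close>-th unit vector minus
  \<open>r\<close> times the \<open>j\<close>-th gives \<open>s * (1 - r\<^sup>2) > 0\<close>. Hence
  the logarithms and denominators of the edge terms are taken at positive numbers.\<close>

lemma pos_def_correlation_bound: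
  fixes A :: "real^'n^'n"
  assumes "pos_def A" and "i \<noteq> j" and "A $ i $ i = s" "A $ j $ j = s" and "A $ i $ j = s * r" and "s > 0"
  shows "r\<^sup>2 < 1"
proof -
  define v :: "real^'n" where "v = axis i 1 - r *\<^sub>R axis j 1"
  have "v $ i = 1" using assms(2) by (simp add: v_def axis_def)
  then have "v \<noteq> 0" by auto
  then have "0 < v \<bullet> (A *v v)" using assms(1) by (simp add: pos_def_def)
  also have "A $ j $ i = s * r"
    using assms(1,5) symmetric_matrix_nth[of A j i] by (simp add: pos_def_def)
  then have "v \<bullet> (A *v v) = s * (1 - r\<^sup>2)"
    using assms(3-5)
    by (simp add: v_def matrix_vector_mult_diff_distrib matrix_vector_mult_scaleR inner_diff_left inner_axis'
        matrix_vector_mult_basis column_def power2_eq_square algebra_simps)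
  finally show ?thesis using assms(6) by (simp add: zero_less_mult_iff)
qed

text \<open>The law of \<open>Y\<close> has a density of the form
  \<open>c0 * exp (- (y \<bullet> (J *v y)) / 2)\<close>, to which the precision criterion applies
  once conditional independence is moved to that law.\<close>

lemma gauss_markov_field_precision_eq_0:
  fixes \<Sigma> :: "real^'n^'n"
  assumes "gauss_markov_field M Y 0 \<Sigma> E" and "i \<noteq> j" and "(i, j) \<notin> E"
  shows "matrix_inv \<Sigma> $ i $ j = 0"
proof -
  have prob: "prob_space M" and pd: "pos_def \<Sigma>" and dist: "distributed M lborel Y (mvn_density 0 \<Sigma>)"
    and ci: "cond_indep_var M (coord_algebra M Y (- {i, j})) (\<lambda>\<omega>. Y \<omega> $ i) (\<lambda>\<omega>. Y \<omega> $ j)"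
    using assms by (auto simp: gauss_markov_field_def gaussian_vector_def)
  have Y: "Y \<in> borel_measurable M" and "distr M lborel Y = density lborel (mvn_density 0 \<Sigma>)"
    using dist by (auto simp: distributed_def)
  moreover have "distr M borel Y = distr M lborel Y" by (rule distr_cong) auto
  moreover have "mvn_density 0 \<Sigma> y =
      1 / sqrt ((2 * pi) ^ CARD('n) * det \<Sigma>) * exp (- (y \<bullet> (matrix_inv \<Sigma> *v y)) / 2)" for y
    by (simp add: mvn_density_def)
  ultimately have distr: "distr M borel Y = density lborel (\<lambda>y. ennreal
      (1 / sqrt ((2 * pi) ^ CARD('n) * det \<Sigma>) * exp (- (y \<bullet> (matrix_inv \<Sigma> *v y)) / 2)))"
    by simp
  have "matrix_inv \<Sigma> $ k $ l = matrix_inv \<Sigma> $ l $ k" for k l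
    by (rule symmetric_matrix_nth[OF transpose_matrix_inv_pos_def[OF pd]])
  with gaussian_cond_indep_precision[OF _ assms(2) _ cond_indep_var_distr[OF prob Y ci, unfolded distr]]
    prob_space.prob_space_distr[OF prob Y, unfolded distr]
  show ?thesis by blast
qed

section \<open>Log-densities under the two hypotheses and the likelihood ratio\<close>

lemma matrix_inv_scaled_identity:
  assumes "(a::real) \<noteq> 0"
  shows "matrix_inv (mat a :: real^'n^'n) = mat (1 / a)"
proof -
  have eq: "mat a ** mat b = (mat (a * b) :: real^'n^'n)" for a b :: real
    by (simp add: vec_eq_iff matrix_matrix_mult_def mat_def if_distrib[of "\<lambda>x. x * _"]
        if_distrib[of "\<lambda>x. _ * x"] cong: if_cong)
  have "(mat a :: real^'n^'n) ** mat (1 / a) = mat 1" "mat (1 / a) ** (mat a :: real^'n^'n) = mat 1"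
    using assms by (simp_all add: eq)
  then show ?thesis by (rule matrix_inv_eqI)
qed

lemma mvn_density_pos:
  fixes \<Sigma> :: "real^'n^'n"
  assumes "det \<Sigma> > 0"
  shows "mvn_density \<mu> \<Sigma> y > 0"
  using assms by (simp add: mvn_density_def)

lemma ln_mvn_density:
  fixes \<Sigma> :: "real^'n^'n"
  assumes "det \<Sigma> > 0"
  shows "ln (mvn_density 0 \<Sigma> y) =
    - (y \<bullet> (matrix_inv \<Sigma> *v y)) / 2 - (real CARD('n) * ln (2 * pi) + ln (det \<Sigma>)) / 2"
  using assms by (simp add: mvn_density_def ln_div ln_sqrt ln_mult ln_realpow algebra_simps)

theorem theorem2:
  fixes x :: "'n::{finite,linorder} \<Rightarrow> real^2"
    and \<sigma>0 \<sigma>1 :: real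
    and g :: "real \<Rightarrow> real"
    and M0 M1 :: "'w measure"
    and Y :: "'w \<Rightarrow> real^('n::{finite,linorder})"
    and \<Sigma>1 :: "real^('n::{finite,linorder})^('n::{finite,linorder})"
    and y :: "real^('n::{finite,linorder})"
  assumes "CARD('n) \<ge> 2"
    and "inj x"
    and "distinct_distances x"
    and "\<sigma>0 > 0" and "\<sigma>1 > 0"
    and H0: "gaussian_vector M0 Y 0 (mat (\<sigma>0\<^sup>2))"
    and H1: "gauss_markov_field M1 Y 0 \<Sigma>1 (nng_edges x)"
    and "pos_def \<Sigma>1"
    and "\<And>i. \<Sigma>1 $ i $ i = \<sigma>1\<^sup>2"
    and "\<And>i j. (i, j) \<in> nng_edges x \<Longrightarrow> \<Sigma>1 $ i $ j = \<sigma>1\<^sup>2 * g (dist (x i) (x j))"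
    and "\<And>i j. (i, j) \<in> nng_edges x \<Longrightarrow> g (dist (x i) (x j)) < 1"
  shows "ln (mvn_density 0 (mat (\<sigma>0\<^sup>2)) y / mvn_density 0 \<Sigma>1 y) =
    real CARD('n) * ln (\<sigma>1 / \<sigma>0) +
    1 / 2 * ((\<Sum>i\<in>UNIV. (1 / \<sigma>1\<^sup>2 - 1 / \<sigma>0\<^sup>2) * (y $ i)\<^sup>2) +
      (\<Sum>(i, j)\<in>{(i, j). (i, j) \<in> nng_edges x \<and> i < j}.
         let \<rho> = g (dist (x i) (x j)) in
           ln (1 - \<rho>\<^sup>2) +
           \<rho>\<^sup>2 / (1 - \<rho>\<^sup>2) * (((y $ i)\<^sup>2 + (y $ j)\<^sup>2) / \<sigma>1\<^sup>2) -
           2 * \<rho> / (1 - \<rho>\<^sup>2) * (y $ i * y $ j / \<sigma>1\<^sup>2)))"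
proof -
  let ?E = "nng_edges x" and ?s = "\<sigma>1\<^sup>2" and ?J = "matrix_inv \<Sigma>1"
  define r where "r i j = g (dist (x i) (x j))" for i j
  have symr: "r i j = r j i" for i j by (simp add: r_def dist_commute)
  have s: "?s > 0" using \<open>\<sigma>1 > 0\<close> by simp
  have symS: "\<Sigma>1 $ k $ l = \<Sigma>1 $ l $ k" for k l
    using \<open>pos_def \<Sigma>1\<close> by (intro symmetric_matrix_nth) (simp add: pos_def_def)
  have symJ: "?J $ k $ l = ?J $ l $ k" for k l
    by (rule symmetric_matrix_nth[OF transpose_matrix_inv_pos_def[OF \<open>pos_def \<Sigma>1\<close>]])
  have symE: "sym ?E" by (auto simp: sym_def nng_edges_def)
  have irr: "irrefl ?E"
    using nn_neq[OF assms(1), of x] unfolding irrefl_def nng_edges_def mem_Collect_eq case_prod_conv by metis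
  have S_edge: "\<Sigma>1 $ k $ l = ?s * r k l" if "(k, l) \<in> ?E" for k l
    using assms(10)[OF that] by (simp add: r_def)
  have sparse: "(k, l) \<in> ?E \<and> k \<in> UNIV \<and> l \<in> UNIV" if "k \<noteq> l" "?J $ k $ l \<noteq> 0" for k l
    using gauss_markov_field_precision_eq_0[OF H1] that by auto
  have leaf: "\<exists>i\<in>W. \<exists>p. \<forall>j\<in>W. (i, j) \<in> ?E \<longrightarrow> j = p" if "W \<noteq> {}" for W
    by (rule nng_leaf[OF assms(1,3) that])
  let ?e = "edges_on ?E UNIV"
  have quad: "y \<bullet> (?J *v y) = (\<Sum>k\<in>UNIV. (y $ k)\<^sup>2 / ?s) + (\<Sum>(k, l)\<in>?e.
      (r k l)\<^sup>2 / (1 - (r k l)\<^sup>2) * (((y $ k)\<^sup>2 + (y $ l)\<^sup>2) / ?s) -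
      2 * r k l / (1 - (r k l)\<^sup>2) * (y $ k * y $ l / ?s))"
    and det: "det \<Sigma>1 = ?s ^ CARD('n) * (\<Prod>(k, l)\<in>?e. 1 - (r k l)\<^sup>2)"
    using forest_precision[where V = UNIV and r = r and y = y, OF leaf symE irr symr _ symS symJ
        pos_def_invertible(1)[OF \<open>pos_def \<Sigma>1\<close>] assms(9) S_edge sparse] s
    by auto
  \<comment> \<open>Every factor of the determinant is positive, so the logarithm of the product
    splits into one term per edge.\<close>
  have pos: "1 - (r k l)\<^sup>2 > 0" if "(k, l) \<in> ?e" for k l
    using pos_def_correlation_bound[OF \<open>pos_def \<Sigma>1\<close> _ assms(9) assms(9) S_edge s, of k l] that
    by (auto simp: edges_on_def)
  have prod_pos: "(\<Prod>(k, l)\<in>?e. 1 - (r k l)\<^sup>2) > 0" using pos by (intro prod_pos) auto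
  have det1: "det \<Sigma>1 > 0" unfolding det using prod_pos s by simp
  have "ln (\<Prod>(k, l)\<in>?e. 1 - (r k l)\<^sup>2) = (\<Sum>(k, l)\<in>?e. ln (1 - (r k l)\<^sup>2))"
    by (subst ln_prod) (auto simp: case_prod_unfold dest: pos)
  then have ln_det1: "ln (det \<Sigma>1) = real CARD('n) * (2 * ln \<sigma>1) + (\<Sum>(k, l)\<in>?e. ln (1 - (r k l)\<^sup>2))"
    unfolding det using prod_pos s \<open>\<sigma>1 > 0\<close>
    by (simp add: ln_mult ln_realpow del: prod_zero_iff)
  have det0_eq: "det (mat (\<sigma>0\<^sup>2) :: real^('n::{finite,linorder})^('n::{finite,linorder})) = (\<sigma>0\<^sup>2) ^ CARD('n)"
    by (subst det_diagonal) (auto simp: mat_def)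
  then have det0: "det (mat (\<sigma>0\<^sup>2) :: real^('n::{finite,linorder})^('n::{finite,linorder})) > 0"
    using \<open>\<sigma>0 > 0\<close> by simp
  have ln_det0: "ln (det (mat (\<sigma>0\<^sup>2) :: real^('n::{finite,linorder})^('n::{finite,linorder}))) =
      real CARD('n) * (2 * ln \<sigma>0)"
    unfolding det0_eq using \<open>\<sigma>0 > 0\<close> by (simp add: ln_realpow)
  have "(mat a :: real^('n::{finite,linorder})^('n::{finite,linorder})) *v y = a *\<^sub>R y" for a
    by (simp add: vec_eq_iff matrix_vector_mult_def mat_def if_distrib[of "\<lambda>x. x * _"] cong: if_cong)
  then have quad0: "y \<bullet> (matrix_inv (mat (\<sigma>0\<^sup>2)) *v y) = (\<Sum>k\<in>UNIV. (y $ k)\<^sup>2 / \<sigma>0\<^sup>2)"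
    using \<open>\<sigma>0 > 0\<close>
    by (simp add: matrix_inv_scaled_identity inner_vec_def power2_eq_square sum_divide_distrib)
  have "ln (mvn_density 0 (mat (\<sigma>0\<^sup>2)) y / mvn_density 0 \<Sigma>1 y) =
      ln (mvn_density 0 (mat (\<sigma>0\<^sup>2)) y) - ln (mvn_density 0 \<Sigma>1 y)"
    by (simp add: ln_div mvn_density_pos[OF det0, THEN less_imp_neq, symmetric]
        mvn_density_pos[OF det1, THEN less_imp_neq, symmetric])
  also have "\<dots> = real CARD('n) * ln (\<sigma>1 / \<sigma>0) +
    1 / 2 * ((\<Sum>i\<in>UNIV. (1 / \<sigma>1\<^sup>2 - 1 / \<sigma>0\<^sup>2) * (y $ i)\<^sup>2) + (\<Sum>(k, l)\<in>?e. ln (1 - (r k l)\<^sup>2) +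
      ((r k l)\<^sup>2 / (1 - (r k l)\<^sup>2) * (((y $ k)\<^sup>2 + (y $ l)\<^sup>2) / ?s) -
      2 * r k l / (1 - (r k l)\<^sup>2) * (y $ k * y $ l / ?s))))"
  proof -
    have "(\<Sum>i\<in>UNIV. (1 / \<sigma>1\<^sup>2 - 1 / \<sigma>0\<^sup>2) * (y $ i)\<^sup>2) =
        (\<Sum>k\<in>UNIV. (y $ k)\<^sup>2 / ?s) - (\<Sum>k\<in>UNIV. (y $ k)\<^sup>2 / \<sigma>0\<^sup>2)"
      by (simp add: sum_subtractf left_diff_distrib)
    moreover have "ln (\<sigma>1 / \<sigma>0) = ln \<sigma>1 - ln \<sigma>0" using assms(4,5) by (simp add: ln_div)
    moreover have "(\<Sum>(k, l)\<in>?e. L k l + Q k l) = (\<Sum>(k, l)\<in>?e. L k l) + (\<Sum>(k, l)\<in>?e. Q k l)"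
      for L Q :: "'n \<Rightarrow> 'n \<Rightarrow> real"
      by (simp add: case_prod_unfold sum.distrib)
    \<comment> \<open>The bookkeeping in abstract form: \<open>l\<close> is the logarithm of
      \<open>2 * pi\<close>, which cancels; \<open>a\<close> and \<open>b\<close> are those of
      \<open>\<sigma>0\<close> and \<open>\<sigma>1\<close>; \<open>q0\<close> and \<open>q1\<close>
      are the sums of squares; \<open>d\<close> and \<open>q\<close> are the edge sums from the
      determinant and from the quadratic form.\<close>
    moreover have "- q0 / 2 - (n * l + n * (2 * a)) / 2 - (- (q1 + q) / 2 - (n * l + (n * (2 * b) + d)) / 2) =
        n * (b - a) + 1 / 2 * ((q1 - q0) + (d + q))" for q0 q1 q n l a b d :: real
      by (simp add: field_simps)
    ultimately show ?thesis
      unfolding ln_mvn_density[OF det0] ln_mvn_density[OF det1] ln_det0 ln_det1 quad quad0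
      by (simp only:)
  qed
  also have "\<dots> = real CARD('n) * ln (\<sigma>1 / \<sigma>0) +
    1 / 2 * ((\<Sum>i\<in>UNIV. (1 / \<sigma>1\<^sup>2 - 1 / \<sigma>0\<^sup>2) * (y $ i)\<^sup>2) +
      (\<Sum>(i, j)\<in>{(i, j). (i, j) \<in> nng_edges x \<and> i < j}.
         let \<rho> = g (dist (x i) (x j)) in
           ln (1 - \<rho>\<^sup>2) +
           \<rho>\<^sup>2 / (1 - \<rho>\<^sup>2) * (((y $ i)\<^sup>2 + (y $ j)\<^sup>2) / \<sigma>1\<^sup>2) -
           2 * \<rho> / (1 - \<rho>\<^sup>2) * (y $ i * y $ j / \<sigma>1\<^sup>2)))"
    by (simp only: edges_on_def UNIV_I simp_thms r_def Let_def add_diff_eq)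
  finally show ?thesis .
qed

end
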